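(* Let $(\lambda_2,\ldots,\lambda_n)$ be any list of complex numbers which is closed under complex conjugation and let $$w=\min\{\pm\Re(\lambda_2),\pm\Im(\lambda_2),\ldots,\pm\Re(\lambda_n),\pm\Im(\lambda_n)\}.$$ Then there exists a least real number $\lambda_0$ with $$\max_{2\le j\le n}|\lambda_j|\le\lambda_0\le (n+2)|w|$$ such that the list of complex numbers $(\lambda_1;\lambda_2,\ldots,\lambda_n)$ is realizable by an $n\times n$ nonnegative generalized doubly stochastic matrix if and only if $\lambda_1\ge\lambda_0$.
   Context: Lists are considered with multiplicity. A real $n\times n$ matrix is generalized doubly stochastic if there is a real number $r\ge 0$ such that every row sum and every column sum equals $r$; it is nonnegative if all its entries are nonnegative. A list $(\lambda_1;\lambda_2,\ldots,\lambda_n)$, with a semicolon after the first entry, is realizable by a nonnegative matrix $A$ if it is the spectrum of $A$ (eigenvalues counted with multiplicity) and $\lambda_1$ is the Perron eigenvalue of $A$ (the nonnegative eigenvalue that is at least the modulus of every other eigenvalue). The notation $\min\{\pm a,\pm b,\ldots\}$ means the minimum of the set containing $a,-a,b,-b,\ldots$. *)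

theory Defs
  imports Complex_Main "Jordan_Normal_Form.Char_Poly"
begin

definition nonneg_matrix :: "real mat \<Rightarrow> bool" where
  "nonneg_matrix A \<longleftrightarrow> (\<forall>i < dim_row A. \<forall>j < dim_col A. 0 \<le> A $$ (i, j))"

definition gen_doubly_stochastic :: "real mat \<Rightarrow> bool" where
  "gen_doubly_stochastic A \<longleftrightarrow> square_mat A \<and>
     (\<exists>r\<ge>0. (\<forall>i < dim_row A. (\<Sum>j < dim_col A. A $$ (i, j)) = r) \<and>
             (\<forall>j < dim_col A. (\<Sum>i < dim_row A. A $$ (i, j)) = r))"

(* Complex eigenvalues of a real matrix, with algebraic multiplicity. *)
definition eigenvalues_mset :: "real mat \<Rightarrow> complex multiset" where
  "eigenvalues_mset A = proots (char_poly (map_mat complex_of_real A))"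

(* The list (x; ls) is realizable by the nonnegative matrix A.  The distinguished entry x is
   the Perron eigenvalue of A, hence a nonnegative real number. *)
definition realizable_by :: "real \<Rightarrow> complex list \<Rightarrow> real mat \<Rightarrow> bool" where
  "realizable_by x ls A \<longleftrightarrow> nonneg_matrix A \<and>
     eigenvalues_mset A = mset (complex_of_real x # ls) \<and>
     0 \<le> x \<and> (\<forall>z \<in> set ls. cmod z \<le> x)"

end

theory Submission
  imports Defs
begin

text \<open>
  Let \<open>Q\<close> be a symmetric orthogonal matrix whose first column is constant. The matrices with all
  row and column sums equal to \<open>x\<close> are exactly the \<open>Q diag(x, D) Q\<close>, and such a matrix has the
  spectrum of \<open>D\<close> together with \<open>x\<close>. Raising \<open>x\<close> to \<open>y\<close> adds \<open>(y - x) / n\<close> to every entry, so the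
  set of admissible \<open>x\<close> is upward closed; it is bounded below by the moduli of the prescribed
  eigenvalues, and closed because the nonnegative matrices with bounded row sums are compact.
  It remains to see that \<open>(n + 2) |w|\<close> is admissible. For this, let \<open>Q\<close> be a Householder reflection,
  which is close to the identity, and let \<open>D\<close> be the real block diagonal matrix with blocks
  \<open>(a)\<close> and \<open>(a, b; -b, a)\<close>: then no entry of \<open>Q diag(0, D) Q\<close> is below \<open>- (1 + 2 / n) |w|\<close>.
\<close>

section \<open>Block diagonal matrices with a prescribed spectrum\<close>

definition row_sum :: "'a :: comm_monoid_add mat \<Rightarrow> nat \<Rightarrow> 'a" where
  "row_sum A i = (\<Sum>j < dim_col A. A $$ (i, j))"

definition col_sum :: "'a :: comm_monoid_add mat \<Rightarrow> nat \<Rightarrow> 'a" where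
  "col_sum A j = (\<Sum>i < dim_row A. A $$ (i, j))"

abbreviation block_diag :: "'a :: zero mat \<Rightarrow> 'a mat \<Rightarrow> 'a mat" where
  "block_diag A B \<equiv>
     four_block_mat A (0\<^sub>m (dim_row A) (dim_col B)) (0\<^sub>m (dim_row B) (dim_col A)) B"

lemma char_poly_block_diag:
  fixes A B :: "'a :: idom mat"
  assumes A: "A \<in> carrier_mat k k" and B: "B \<in> carrier_mat l l"
  shows "char_poly (block_diag A B) = char_poly A * char_poly B"
proof -
  have "char_poly_matrix (block_diag A B) =
      four_block_mat (char_poly_matrix A) (0\<^sub>m k l) (0\<^sub>m l k) (char_poly_matrix B)"
    using A B by (intro eq_matI) (auto simp: char_poly_matrix_def)
  then show ?thesis
    unfolding char_poly_def
    using det_four_block_mat_lower_left_zero[of "char_poly_matrix A" k "0\<^sub>m k l" l "0\<^sub>m l k"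
        "char_poly_matrix B"] A B
    by auto
qed

lemma sum_lessThan_add:
  fixes f :: "nat \<Rightarrow> 'a :: comm_monoid_add"
  shows "sum f {..<k + l} = sum f {..<k} + (\<Sum>j<l. f (k + j))"
  by (induction l) (simp_all add: add.assoc)

lemma row_sum_block_diag:
  assumes A: "A \<in> carrier_mat k k" and B: "B \<in> carrier_mat l l" and "i < k + l"
  shows "row_sum (block_diag A B) i = (if i < k then row_sum A i else row_sum B (i - k))"
  using assms by (auto simp: row_sum_def sum_lessThan_add)

lemma col_sum_block_diag:
  assumes A: "A \<in> carrier_mat k k" and B: "B \<in> carrier_mat l l" and "j < k + l"
  shows "col_sum (block_diag A B) j = (if j < k then col_sum A j else col_sum B (j - k))"
  using assms by (auto simp: col_sum_def sum_lessThan_add)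

text \<open>The last bound on the entries is the one that makes
  \<open>D\<^sub>i\<^sub>j - q (row_sum D i + col_sum D j) \<ge> - w\<close> hold for \<open>q = 1 / 4\<close>; since this is affine in \<open>q\<close>, it
  then holds for all \<open>q\<close> between \<open>0\<close> and \<open>1 / 4\<close>, and such a \<open>q\<close> occurs in the reflection below.\<close>

definition balanced :: "real \<Rightarrow> real mat \<Rightarrow> bool" where
  "balanced w D \<longleftrightarrow>
     (\<forall>i < dim_row D. \<forall>j < dim_col D.
        \<bar>D $$ (i, j)\<bar> \<le> w \<and> \<bar>row_sum D i\<bar> \<le> 2 * w \<and> \<bar>col_sum D j\<bar> \<le> 2 * w \<and>
        \<bar>4 * D $$ (i, j) - row_sum D i - col_sum D j\<bar> \<le> 4 * w) \<and>
     \<bar>\<Sum>i < dim_row D. row_sum D i\<bar> \<le> real (dim_row D) * w"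

text \<open>In the off-diagonal blocks the entry is zero, so the mixed condition becomes a bound
  \<open>4 * w\<close> on the sum of one row sum and one column sum. It follows from the separate
  bounds \<open>2 * w\<close>, which is why \<open>balanced\<close> records them.\<close>

lemma balanced_block_diag:
  assumes A: "A \<in> carrier_mat k k" and B: "B \<in> carrier_mat l l"
    and bA: "balanced w A" and bB: "balanced w B" and "0 \<le> w"
  shows "balanced w (block_diag A B)"
proof -
  let ?E = "block_diag A B"
  have dim: "dim_row A = k" "dim_col A = k" "dim_row B = l" "dim_col B = l"
    using A B by auto
  note sums = row_sum_block_diag[OF A B, unfolded dim] col_sum_block_diag[OF A B, unfolded dim]
  have RA: "\<bar>row_sum A i\<bar> \<le> 2 * w" "\<bar>col_sum A i\<bar> \<le> 2 * w" if "i < k" for i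
    using bA that dim unfolding balanced_def by auto
  have RB: "\<bar>row_sum B i\<bar> \<le> 2 * w" "\<bar>col_sum B i\<bar> \<le> 2 * w" if "i < l" for i
    using bB that dim unfolding balanced_def by auto
  have eA: "\<bar>A $$ (i, j)\<bar> \<le> w" "\<bar>4 * A $$ (i, j) - row_sum A i - col_sum A j\<bar> \<le> 4 * w"
    if "i < k" "j < k" for i j
    using bA that dim unfolding balanced_def by auto
  have eB: "\<bar>B $$ (i, j)\<bar> \<le> w" "\<bar>4 * B $$ (i, j) - row_sum B i - col_sum B j\<bar> \<le> 4 * w"
    if "i < l" "j < l" for i j
    using bB that dim unfolding balanced_def by auto
  have "(\<Sum>i < k + l. row_sum ?E i) = (\<Sum>i < k. row_sum A i) + (\<Sum>i < l. row_sum B i)"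
    by (simp add: sum_lessThan_add row_sum_block_diag[OF A B])
  moreover have "\<bar>\<Sum>i < k. row_sum A i\<bar> \<le> real k * w" "\<bar>\<Sum>i < l. row_sum B i\<bar> \<le> real l * w"
    using bA bB dim unfolding balanced_def by auto
  ultimately have tot: "\<bar>\<Sum>i < k + l. row_sum ?E i\<bar> \<le> real (k + l) * w"
    by (simp add: distrib_right)
  have "\<bar>?E $$ (i, j)\<bar> \<le> w \<and> \<bar>row_sum ?E i\<bar> \<le> 2 * w \<and> \<bar>col_sum ?E j\<bar> \<le> 2 * w \<and>
        \<bar>4 * ?E $$ (i, j) - row_sum ?E i - col_sum ?E j\<bar> \<le> 4 * w"
    if "i < k + l" "j < k + l" for i j
  proof -
    have l: "i - k < l" if "\<not> i < k" using \<open>i < k + l\<close> that by auto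
    have l': "j - k < l" if "\<not> j < k" using \<open>j < k + l\<close> that by auto
    consider "i < k" "j < k" | "i < k" "\<not> j < k" | "\<not> i < k" "j < k" | "\<not> i < k" "\<not> j < k"
      by blast
    then show ?thesis
    proof cases
      case 1
      then show ?thesis
        using RA[of i] RA[of j] eA[of i j] that dim
        by (simp add: sums)
    next
      case 2
      then show ?thesis
        using RA[of i] RB[of "j - k"] l' that dim \<open>0 \<le> w\<close>
        by (simp add: sums)
    next
      case 3
      then show ?thesis
        using RB[of "i - k"] RA[of j] l that dim \<open>0 \<le> w\<close>
        by (simp add: sums)
    next
      case 4
      then show ?thesis
        using RB[of "i - k"] RB[of "j - k"] eB[of "i - k" "j - k"] l l' that dim
        by (simp add: sums)
    qed
  qed
  then show ?thesis
    using tot dim by (auto simp: balanced_def)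
qed

section \<open>Real matrices with a prescribed complex spectrum\<close>

abbreviation linear_factors :: "complex multiset \<Rightarrow> complex poly" where
  "linear_factors M \<equiv> (\<Prod>z\<in>#M. [:- z, 1:])"

lemma proots_linear_factors: "proots (linear_factors M) = M"
proof (induction M)
  case (add z M)
  have "linear_factors M \<noteq> 0" by (auto simp: prod_mset_zero_iff)
  then have "proots ([:- z, 1:] * linear_factors M) = proots [:- z, 1:] + proots (linear_factors M)"
    by (intro proots_mult) auto
  then show ?case using add by (simp del: mult_pCons_left)
qed simp

lemma map_poly_complex_of_real_mult:
  "map_poly complex_of_real (p * q) = map_poly of_real p * map_poly of_real q"
proof -
  interpret map_poly_comm_ring_hom complex_of_real ..
  show ?thesis by (rule hom_mult)
qed

lemma complex_char_poly:
  assumes "A \<in> carrier_mat n n"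
  shows "char_poly (map_mat complex_of_real A) = map_poly of_real (char_poly A)"
  using of_real_hom.char_poly_hom[OF assms] by simp

text \<open>A monic complex polynomial splits and is determined by its roots. The polynomial form is
  preferred below because it multiplies along blocks and passes to limits.\<close>

lemma eigenvalues_mset_eq_iff:
  assumes "A \<in> carrier_mat n n"
  shows "eigenvalues_mset A = M \<longleftrightarrow> map_poly complex_of_real (char_poly A) = linear_factors M"
proof -
  have "monic (char_poly (map_mat complex_of_real A))"
    using degree_monic_char_poly[of "map_mat complex_of_real A" n] assms by auto
  then have "linear_factors (eigenvalues_mset A) = char_poly (map_mat complex_of_real A)"
    using complex_poly_decompose_multiset[of "char_poly (map_mat complex_of_real A)"]
    by (simp add: eigenvalues_mset_def)
  then show ?thesis
    using proots_linear_factors complex_char_poly[OF assms]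
    by (metis eigenvalues_mset_def)
qed

lemma char_poly_real_block: "char_poly (mat 1 1 (\<lambda>_. a :: 'a :: comm_ring_1)) = [:- a, 1:]"
  by (simp add: char_poly_defs det_single)

lemma det_mat_2:
  assumes "(A :: 'a :: comm_ring_1 mat) \<in> carrier_mat 2 2"
  shows "det A = A $$ (0, 0) * A $$ (1, 1) - A $$ (0, 1) * A $$ (1, 0)"
  using assms laplace_expansion_row[of A 2 0]
  by (auto simp: numeral_2_eq_2 cofactor_def det_single mat_delete_def)

lemma char_poly_rotation_block:
  "char_poly (mat 2 2 (\<lambda>(i, j). if i = j then a else if i < j then b else - b :: 'a :: comm_ring_1))
     = [:a * a + b * b, - (2 * a), 1:]"
  by (simp add: char_poly_defs det_mat_2)

text \<open>Strong induction on the size: split off a real \<open>z\<close> as a block of size 1, or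
  a pair \<open>z\<close>, \<open>cnj z\<close> as a block (a, b; -b, a). For the mixed condition,
  the first block gives 2a, and the second gives 2a on its diagonal and 2(b - a), -2(a + b) off it,
  all at most 4w in modulus.\<close>

lemma balanced_realization:
  assumes "image_mset cnj M = M" and "\<And>z. z \<in># M \<Longrightarrow> \<bar>Re z\<bar> \<le> w \<and> \<bar>Im z\<bar> \<le> w" and "0 \<le> w"
  shows "\<exists>D \<in> carrier_mat (size M) (size M).
           map_poly complex_of_real (char_poly D) = linear_factors M \<and> balanced w D"
  using assms(1,2)
proof (induction "size M" arbitrary: M rule: less_induct)
  case less
  show ?case
  proof (cases "M = {#}")
    case True
    have "char_poly (0\<^sub>m 0 0 :: real mat) = 1"
      by (simp add: char_poly_defs det_def)
    then show ?thesis
      using True by (intro bexI[of _ "0\<^sub>m 0 0"]) (auto simp: balanced_def)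
  next
    case False
    then obtain z where z: "z \<in># M" by auto
    \<comment> \<open>The induction step shared by both kinds of block: removing a nonempty
      conjugation-closed \<open>K\<close> leaves a smaller conjugation-closed
      \<open>N\<close>.\<close>
    have extend: ?thesis
      if E: "E \<in> carrier_mat (size K) (size K)" "balanced w E" "size K > 0"
        "map_poly complex_of_real (char_poly E) = linear_factors K"
        "image_mset cnj K = K" and M: "M = K + N" for E K N
    proof -
      have "image_mset cnj N = N" using less.prems(1) that(5) unfolding M by simp
      then obtain D where D: "D \<in> carrier_mat (size N) (size N)" "balanced w D"
        "map_poly complex_of_real (char_poly D) = linear_factors N"
        using less.hyps[of N] less.prems(2) E(3) unfolding M by auto
      show ?thesis
      proof (intro bexI[of _ "block_diag E D"] conjI)
        show "map_poly complex_of_real (char_poly (block_diag E D)) = linear_factors M"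
          using E(4) D(3) by (simp add: char_poly_block_diag[OF E(1) D(1)] M map_poly_complex_of_real_mult)
        show "balanced w (block_diag E D)"
          by (rule balanced_block_diag[OF E(1) D(1) E(2) D(2) assms(3)])
        show "block_diag E D \<in> carrier_mat (size M) (size M)"
          using E(1) D(1) unfolding M by auto
      qed
    qed
    have zw: "\<bar>Re z\<bar> \<le> w" "\<bar>Im z\<bar> \<le> w" using less.prems(2) z by auto
    obtain N where N: "M = {#z#} + N" using z by (metis insert_DiffM add_mset_add_single add.commute)
    show ?thesis
    proof (cases "cnj z = z")
      case True
      then have "z = complex_of_real (Re z)"
        by (metis Reals_cnj_iff of_real_Re)
      define E where "E = mat 1 1 (\<lambda>_. Re z)"
      show ?thesis
      proof (rule extend[OF _ _ _ _ _ N])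
        show "E \<in> carrier_mat (size {#z#}) (size {#z#})" by (simp add: E_def)
        have "\<bar>Re z\<bar> \<le> 2 * w" "\<bar>2 * Re z\<bar> \<le> 4 * w" using zw by linarith+
        then show "balanced w E"
          using zw by (simp add: balanced_def E_def row_sum_def col_sum_def)
        have "char_poly E = [:- Re z, 1:]" unfolding E_def by (rule char_poly_real_block)
        then show "map_poly complex_of_real (char_poly E) = linear_factors {#z#}"
          using \<open>z = complex_of_real (Re z)\<close> by (simp add: map_poly_pCons)
      qed (use True in auto)
    next
      case False
      have "cnj z \<in># M" using z less.prems(1) by (metis image_eqI set_image_mset)
      then have "cnj z \<in># N" using N False by auto
      then obtain N' where N': "N = {#cnj z#} + N'"
        by (metis insert_DiffM add_mset_add_single add.commute)
      define E where
        "E = mat 2 2 (\<lambda>(i, j). if i = j then Re z else if i < j then Im z else - Im z)"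
      have M: "M = {#z, cnj z#} + N'" using N N' by simp
      show ?thesis
      proof (rule extend[OF _ _ _ _ _ M])
        show "E \<in> carrier_mat (size {#z, cnj z#}) (size {#z, cnj z#})"
          by (simp add: E_def numeral_2_eq_2)
        have "row_sum E i = (if i = 0 then Re z + Im z else Re z - Im z)"
          "col_sum E i = (if i = 0 then Re z - Im z else Re z + Im z)" if "i < 2" for i
          using that by (auto simp: row_sum_def col_sum_def E_def numeral_2_eq_2 less_Suc_eq)
        then show "balanced w E"
          using zw by (auto simp: balanced_def E_def numeral_2_eq_2 less_Suc_eq All_less_Suc)
        have "char_poly E = [:Re z * Re z + Im z * Im z, - (2 * Re z), 1:]"
          unfolding E_def by (rule char_poly_rotation_block)
        then show "map_poly complex_of_real (char_poly E) = linear_factors {#z, cnj z#}"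
          by (simp add: map_poly_pCons complex_eq_iff)
      qed auto
    qed
  qed
qed


section \<open>The reflection onto the constant vector\<close>

lemma index_triple_mult:
  fixes P B R :: "'a :: comm_semiring_0 mat"
  assumes "P \<in> carrier_mat n n" "B \<in> carrier_mat n n" "R \<in> carrier_mat n n" "i < n" "j < n"
  shows "(P * B * R) $$ (i, j) = (\<Sum>k<n. \<Sum>l<n. P $$ (i, k) * B $$ (k, l) * R $$ (l, j))"
  using assms by (simp add: scalar_prod_def lessThan_atLeast0 sum_distrib_left mult.assoc)

text \<open>The Householder reflection that maps the first unit vector to the constant vector with
  entries \<open>- 1 / sqrt (m + 1)\<close>.\<close>

definition reflector_shift :: "nat \<Rightarrow> real" where
  "reflector_shift m = 1 / (real (Suc m) + sqrt (real (Suc m)))"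

definition reflector :: "nat \<Rightarrow> real mat" where
  "reflector m = mat (Suc m) (Suc m) (\<lambda>(i, j).
     if i = 0 \<or> j = 0 then - (1 / sqrt (real (Suc m)))
     else (if i = j then 1 else 0) - reflector_shift m)"

lemma reflector_carrier [simp]: "reflector m \<in> carrier_mat (Suc m) (Suc m)"
  by (simp add: reflector_def)

lemma reflector_index:
  "i \<le> m \<Longrightarrow> reflector m $$ (i, 0) = - (1 / sqrt (real (Suc m)))"
  "j \<le> m \<Longrightarrow> reflector m $$ (0, j) = - (1 / sqrt (real (Suc m)))"
  "i < m \<Longrightarrow> j < m \<Longrightarrow>
     reflector m $$ (Suc i, Suc j) = (if i = j then 1 else 0) - reflector_shift m"
  by (auto simp: reflector_def)

text \<open>With s = sqrt(m + 1), both u = 1/s and q = 1/(s(s + 1)) are rational in s, and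
  everything reduces to q(s + 1) = u. The last identity shows that q is the Householder coefficient
  u^2/(1 + u).\<close>

lemma reflector_shift_identities:
  fixes m :: nat
  defines "u \<equiv> 1 / sqrt (real (Suc m))" and "q \<equiv> reflector_shift m"
  shows "u * u = 1 / real (Suc m)" "real m * q = 1 - u" "q * (1 + u) = u * u"
proof -
  define s where "s = sqrt (real (Suc m))"
  have s: "s > 0" "s * s = real m + 1" unfolding s_def by auto
  have q: "q = 1 / (s * s + s)" using s by (simp add: q_def reflector_shift_def s_def add.commute)
  have m: "real m = s * s - 1" using s by simp
  have "s * s + s > 0" using s by (simp add: add_pos_pos)
  show "u * u = 1 / real (Suc m)" by (simp add: u_def)
  have "u * s = 1" using s by (simp add: u_def s_def)
  moreover have "q * (s * (s + 1)) = 1"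
    using nonzero_eq_divide_eq[of "s * s + s" q 1] q \<open>s * s + s > 0\<close> by (auto simp: distrib_left)
  moreover have "q * (s * (s + 1)) * u = q * (s + 1) * (u * s)" by (simp only: ac_simps)
  ultimately have qs: "q * (s + 1) = u" by simp
  have "real m * q = (q * (s + 1)) * (s - 1)" by (simp add: m algebra_simps)
  also have "\<dots> = 1 - u" unfolding qs using \<open>u * s = 1\<close> by (simp add: algebra_simps)
  finally show "real m * q = 1 - u" .
  have "q * (1 + u) = q * (u * s + u)" using \<open>u * s = 1\<close> by simp
  also have "\<dots> = u * (q * (s + 1))" by (simp add: algebra_simps)
  finally have "q * (1 + u) = u * (q * (s + 1))" .
  then show "q * (1 + u) = u * u" unfolding qs .
qed

lemma reflector_shift_bounds:
  "0 < reflector_shift m" "reflector_shift m \<le> 1 / real (Suc m)"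
  "1 < m \<Longrightarrow> reflector_shift m \<le> 1 / 4"
proof -
  have s: "sqrt (real (Suc m)) \<ge> 1" by simp
  show "0 < reflector_shift m" by (simp add: reflector_shift_def add_pos_pos)
  show "reflector_shift m \<le> 1 / real (Suc m)"
    unfolding reflector_shift_def using s
    by (intro divide_left_mono mult_pos_pos add_pos_nonneg) auto
  assume "1 < m"
  then have "4 \<le> real (Suc m) + sqrt (real (Suc m))" using s by linarith
  then show "reflector_shift m \<le> 1 / 4"
    unfolding reflector_shift_def by (intro divide_left_mono mult_pos_pos) auto
qed

text \<open>The action of I - qJ, J being the all-ones matrix, on a vector. Up to sign and border,
  this is how the reflection acts; the three forms match the index orders that occur in the
  products.\<close>

lemma sum_delta_shift:
  fixes f :: "nat \<Rightarrow> real"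
  assumes "i < m"
  shows "(\<Sum>k<m. ((if i = k then 1 else 0) - q) * f k) = f i - q * sum f {..<m}"
    "(\<Sum>k<m. ((if k = i then 1 else 0) - q) * f k) = f i - q * sum f {..<m}"
    "(\<Sum>k<m. f k * ((if k = i then 1 else 0) - q)) = f i - q * sum f {..<m}"
proof -
  have *: "(\<Sum>k<m. ((if i = k then 1 else 0) - q) * f k)
      = (\<Sum>k<m. (if i = k then f k else 0)) - (\<Sum>k<m. q * f k)"
    unfolding sum_subtractf[symmetric] by (intro sum.cong) (auto simp: algebra_simps)
  show 1: "(\<Sum>k<m. ((if i = k then 1 else 0) - q) * f k) = f i - q * sum f {..<m}"
    unfolding * using assms by (simp add: sum_distrib_left)
  then show 2: "(\<Sum>k<m. ((if k = i then 1 else 0) - q) * f k) = f i - q * sum f {..<m}"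
    by (simp add: eq_commute[of i])
  then show "(\<Sum>k<m. f k * ((if k = i then 1 else 0) - q)) = f i - q * sum f {..<m}"
    by (simp add: mult.commute)
qed

text \<open>Apart from the corner, the entries of the square reduce by 1 - qm = u: the border ones
  to u^2 - u^2, the inner ones to u^2 + delta - q - qu, which is delta by q(1 + u) = u^2.\<close>

lemma reflector_involution: "reflector m * reflector m = 1\<^sub>m (Suc m)"
proof (rule eq_matI)
  fix i j assume "i < dim_row (1\<^sub>m (Suc m))" "j < dim_col (1\<^sub>m (Suc m))"
  then have ij: "i < Suc m" "j < Suc m" by auto
  define u where "u = 1 / sqrt (real (Suc m))"
  define q where "q = reflector_shift m"
  note id = reflector_shift_identities[of m, folded u_def q_def]
  note index = reflector_index[of _ m, folded u_def q_def]
  have e: "1 - q * real m = u" using id(2) by (simp add: mult.commute)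
  have "(reflector m * reflector m) $$ (i, j)
      = (\<Sum>k<Suc m. reflector m $$ (i, k) * reflector m $$ (k, j))"
    using ij by (simp add: scalar_prod_def lessThan_atLeast0 reflector_def)
  also have "\<dots> = reflector m $$ (i, 0) * reflector m $$ (0, j)
      + (\<Sum>k<m. reflector m $$ (i, Suc k) * reflector m $$ (Suc k, j))"
    by (rule sum.lessThan_Suc_shift)
  also have "\<dots> = (if i = j then 1 else 0)"
  proof (cases i)
    case 0
    note i = this
    show ?thesis
    proof (cases j)
      case 0
      then show ?thesis using i id(1) by (simp add: index field_simps)
    next
      case (Suc j')
      then have "j' < m" using ij by simp
      then have S: "(\<Sum>k<m. reflector m $$ (0, Suc k) * reflector m $$ (Suc k, j)) = - u * (1 - q * m)"
        using sum_delta_shift(3)[of j' m "\<lambda>_. - u" q] by (simp add: index Suc right_diff_distrib mult.commute)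
      show ?thesis unfolding i S e using Suc ij by (simp add: index)
    qed
  next
    case (Suc i')
    note i = this
    then have i': "i' < m" using ij by simp
    show ?thesis
    proof (cases j)
      case 0
      then have S: "(\<Sum>k<m. reflector m $$ (i, Suc k) * reflector m $$ (Suc k, 0)) = - u * (1 - q * m)"
        using sum_delta_shift(1)[of i' m q "\<lambda>_. - u"] i' by (simp add: index Suc right_diff_distrib mult.commute)
      show ?thesis unfolding 0 S e using i ij by (simp add: index)
    next
      case (Suc j')
      then have j': "j' < m" using ij by simp
      have "(\<Sum>k<m. reflector m $$ (i, Suc k) * reflector m $$ (Suc k, j))
          = ((if i' = j' then 1 else 0) - q) - q * (1 - q * m)"
        using sum_delta_shift(1)[OF i', of q "\<lambda>k. (if k = j' then 1 else 0) - q"]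
          sum_delta_shift(2)[OF j', of q "\<lambda>_. 1"] i' j'
        by (simp add: index Suc i)
      then show ?thesis unfolding e using i Suc ij id by (simp add: index algebra_simps)
    qed
  qed
  also have "\<dots> = 1\<^sub>m (Suc m) $$ (i, j)" using ij by simp
  finally show "(reflector m * reflector m) $$ (i, j) = 1\<^sub>m (Suc m) $$ (i, j)" .
qed (auto simp: reflector_def)

section \<open>Conjugating diag(x, D) by the reflection\<close>

definition conjugated :: "real \<Rightarrow> real mat \<Rightarrow> real mat" where
  "conjugated x D = (let Q = reflector (dim_row D) in Q * block_diag (mat 1 1 (\<lambda>_. x)) D * Q)"

lemma conjugated_carrier [simp]:
  "D \<in> carrier_mat m m \<Longrightarrow> conjugated x D \<in> carrier_mat (Suc m) (Suc m)"
  by (auto simp: conjugated_def Let_def reflector_def)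

lemma conjugated_eq:
  "D \<in> carrier_mat m m \<Longrightarrow>
    conjugated x D = reflector m * block_diag (mat 1 1 (\<lambda>_. x)) D * reflector m"
  by (auto simp: conjugated_def Let_def)

text \<open>The first row and column of the reflection are constant, so \<open>x\<close> contributes
  the same amount to every entry. Separating it from the part that depends on \<open>D\<close> gives
  both the monotonicity in \<open>x\<close> and the entry bounds.\<close>

lemma conjugated_index:
  assumes D: "D \<in> carrier_mat m m" and "i \<le> m" "j \<le> m"
  shows "conjugated x D $$ (i, j) = x / real (Suc m) +
    (\<Sum>k<m. \<Sum>l<m. reflector m $$ (i, Suc k) * D $$ (k, l) * reflector m $$ (Suc l, j))"
proof -
  define E where "E = block_diag (mat 1 1 (\<lambda>_. x)) D"
  have E: "E \<in> carrier_mat (Suc m) (Suc m)"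
    "E $$ (0, 0) = x" "\<And>k l. k < m \<Longrightarrow> l < m \<Longrightarrow> E $$ (Suc k, Suc l) = D $$ (k, l)"
    "\<And>k. k < m \<Longrightarrow> E $$ (Suc k, 0) = 0" "\<And>l. l < m \<Longrightarrow> E $$ (0, Suc l) = 0"
    using D by (auto simp: E_def)
  have "conjugated x D $$ (i, j) =
     (\<Sum>k<Suc m. \<Sum>l<Suc m. reflector m $$ (i, k) * E $$ (k, l) * reflector m $$ (l, j))"
    unfolding conjugated_eq[OF D] E_def[symmetric] using assms by (intro index_triple_mult E(1)) auto
  also have "\<dots> = reflector m $$ (i, 0) * x * reflector m $$ (0, j) +
    (\<Sum>k<m. \<Sum>l<m. reflector m $$ (i, Suc k) * D $$ (k, l) * reflector m $$ (Suc l, j))"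
    unfolding sum.lessThan_Suc_shift by (simp add: E)
  also have "reflector m $$ (i, 0) * x * reflector m $$ (0, j) = x / real (Suc m)"
    using assms(2,3) reflector_shift_identities(1)[of m] by (simp add: reflector_index)
  finally show ?thesis .
qed

lemma conjugated_char_poly:
  assumes D: "D \<in> carrier_mat m m"
  shows "char_poly (conjugated x D) = [:- x, 1:] * char_poly D"
proof -
  let ?E = "block_diag (mat 1 1 (\<lambda>_. x)) D"
  have "?E \<in> carrier_mat (Suc m) (Suc m)" using D by auto
  then have "similar_mat (conjugated x D) ?E"
    using D reflector_involution[of m] conjugated_carrier[OF D]
    by (intro similar_matI[of _ _ "reflector m" "reflector m" "Suc m"]) (auto simp: conjugated_eq)
  then have "char_poly (conjugated x D) = char_poly ?E" by (rule char_poly_similar)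
  also have "\<dots> = char_poly (mat 1 1 (\<lambda>_. x)) * char_poly D"
    using D by (intro char_poly_block_diag[of _ 1 _ m]) auto
  finally show ?thesis unfolding char_poly_real_block .
qed

text \<open>With T the sum of all entries of \<open>D\<close>, the part \<open>?N\<close>
  independent of \<open>x\<close> is u^2 T at the corner, -u(S - qT) on the border, where S is a
  column or row sum of \<open>D\<close>, and D_ij - q(row sum + column sum) + q^2 T inside. Each is
  at least -(1 + 2u^2)w, where u^2 = 1/(m + 1).\<close>

lemma conjugated_lower_bound:
  assumes D: "D \<in> carrier_mat m m" and b: "balanced w D" and "0 < m" "0 \<le> w" and ij: "i \<le> m" "j \<le> m"
  shows "conjugated x D $$ (i, j) \<ge> x / real (Suc m) - (1 + 2 / real (Suc m)) * w"
proof -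
  define u where "u = 1 / sqrt (real (Suc m))"
  define q where "q = reflector_shift m"
  define T where "T = (\<Sum>i<m. row_sum D i)"
  let ?N = "\<Sum>k<m. \<Sum>l<m. reflector m $$ (i, Suc k) * D $$ (k, l) * reflector m $$ (Suc l, j)"
  note id = reflector_shift_identities[of m, folded u_def q_def]
  note index = reflector_index[of _ m, folded u_def q_def]
  note bounds = reflector_shift_bounds[of m, folded q_def]
  have dim: "dim_row D = m" "dim_col D = m" using D by auto
  have R: "(\<Sum>l<m. D $$ (k, l)) = row_sum D k" for k by (simp add: row_sum_def dim)
  have C: "(\<Sum>k<m. D $$ (k, l)) = col_sum D l" for l by (simp add: col_sum_def dim)
  have TC: "T = (\<Sum>l<m. col_sum D l)"
    unfolding T_def R[symmetric] C[symmetric] by (rule sum.swap)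
  have T: "\<bar>T\<bar> \<le> real m * w" using b dim by (simp add: balanced_def T_def)
  have entries: "\<bar>D $$ (k, l)\<bar> \<le> w" "\<bar>row_sum D k\<bar> \<le> 2 * w" "\<bar>col_sum D l\<bar> \<le> 2 * w"
    "\<bar>4 * D $$ (k, l) - row_sum D k - col_sum D l\<bar> \<le> 4 * w" if "k < m" "l < m" for k l
    using b that dim by (auto simp: balanced_def)
  have u0: "0 < u" "u \<le> 1" by (simp_all add: u_def)
  have u2: "2 / real (Suc m) = 2 * (u * u)" using id(1) by simp
  have qT: "\<bar>q * T\<bar> \<le> (1 - u) * w"
  proof -
    have "\<bar>q * T\<bar> \<le> q * (real m * w)"
      using T bounds(1) by (simp add: abs_mult mult_left_mono)
    also have "\<dots> = (1 - u) * w" by (simp add: id(2)[symmetric] ac_simps)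
    finally show ?thesis .
  qed
  \<comment> \<open>After division by w this is 3u^2 - 3u + 1 >= 0, proved by completing the
    square.\<close>
  have side: "u * (2 * w + (1 - u) * w) \<le> (1 + 2 * (u * u)) * w"
  proof -
    have "0 \<le> 3 * (u - 1 / 2)\<^sup>2 + 1 / 4" by simp
    then have "u * (3 - u) \<le> 1 + 2 * (u * u)" by (simp add: power2_eq_square algebra_simps)
    from mult_right_mono[OF this \<open>0 \<le> w\<close>] show ?thesis by (simp add: algebra_simps)
  qed
  have edge: "- u * (S - q * T) \<ge> - ((1 + 2 * (u * u)) * w)" if "\<bar>S\<bar> \<le> 2 * w" for S
  proof -
    have "u * (S - q * T) \<le> u * (2 * w + (1 - u) * w)"
      using that qT u0 by (intro mult_left_mono) auto
    then show ?thesis using side by simp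
  qed
  have "?N \<ge> - ((1 + 2 * (u * u)) * w)"
  proof (cases i)
    case 0
    note i = this
    show ?thesis
    proof (cases j)
      case 0
      then have "?N = (\<Sum>k<m. \<Sum>l<m. u * u * D $$ (k, l))"
        using i by (simp add: index ac_simps)
      also have "\<dots> = u * u * T" by (simp add: sum_distrib_left[symmetric] R T_def)
      finally have N: "?N = u * u * T" .
      have "u * u * T \<ge> u * u * (- (real m * w))"
        using T u0 by (intro mult_left_mono) auto
      moreover have "u * u * (- (real m * w)) \<ge> - w"
        using \<open>0 \<le> w\<close> by (simp add: id(1) field_simps)
      ultimately have "?N \<ge> - w" using N by linarith
      moreover have "0 \<le> u * u * w" using \<open>0 \<le> w\<close> by simp
      ultimately show ?thesis by (simp add: algebra_simps)
    next
      case (Suc j')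
      then have j': "j' < m" using ij by simp
      have "?N = (\<Sum>l<m. \<Sum>k<m. - u * D $$ (k, l) * ((if l = j' then 1 else 0) - q))"
        using i j' by (subst sum.swap) (simp add: index Suc)
      also have "\<dots> = (\<Sum>l<m. - u * col_sum D l * ((if l = j' then 1 else 0) - q))"
        by (simp only: sum_distrib_left[symmetric] sum_distrib_right[symmetric] C)
      also have "\<dots> = - u * (col_sum D j' - q * T)"
        unfolding sum_delta_shift(3)[OF j'] TC sum_distrib_left[symmetric] by (simp add: algebra_simps)
      finally show ?thesis using edge[of "col_sum D j'"] entries[OF j' j'] by simp
    qed
  next
    case (Suc i')
    note i = this
    then have i': "i' < m" using ij by simp
    show ?thesis
    proof (cases j)
      case 0
      have "?N = (\<Sum>k<m. \<Sum>l<m. ((if i' = k then 1 else 0) - q) * D $$ (k, l) * - u)"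
        using i i' 0 by (simp add: index)
      also have "\<dots> = (\<Sum>k<m. ((if i' = k then 1 else 0) - q) * (row_sum D k * - u))"
        by (simp only: sum_distrib_left[symmetric] sum_distrib_right[symmetric] R mult.assoc)
      also have "\<dots> = - u * (row_sum D i' - q * T)"
        unfolding sum_delta_shift(1)[OF i'] T_def sum_distrib_right[symmetric] by (simp add: algebra_simps)
      finally show ?thesis using edge[of "row_sum D i'"] entries[OF i' i'] by simp
    next
      case (Suc j')
      then have j': "j' < m" using ij by simp
      have "?N = (\<Sum>k<m. \<Sum>l<m. ((if i' = k then 1 else 0) - q) *
           (D $$ (k, l) * ((if l = j' then 1 else 0) - q)))"
        using i i' Suc j' by (simp add: index mult.assoc)
      also have "\<dots> = (\<Sum>k<m. ((if i' = k then 1 else 0) - q) * (D $$ (k, j') - q * row_sum D k))"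
        by (simp only: sum_distrib_left[symmetric] sum_delta_shift(3)[OF j'] R)
      also have "\<dots> = D $$ (i', j') - q * row_sum D i' - q * (col_sum D j' - q * T)"
        unfolding sum_delta_shift(1)[OF i'] by (simp add: sum_subtractf C sum_distrib_left[symmetric] T_def)
      finally have N: "?N = D $$ (i', j') - q * (row_sum D i' + col_sum D j') + q * (q * T)"
        by (simp add: algebra_simps)
      \<comment> \<open>The correction q^2 T only has to fit into the slack 2u^2 w; the bound q <=
        u^2 is enough for that.\<close>
      have "\<bar>q * (q * T)\<bar> \<le> u * u * w"
      proof -
        have "\<bar>q * (q * T)\<bar> \<le> q * ((1 - u) * w)"
          using qT bounds(1) by (simp add: abs_mult mult_left_mono)
        also have "\<dots> \<le> q * w"
          using bounds(1) u0 \<open>0 \<le> w\<close> by (intro mult_left_mono) (auto simp: left_diff_distrib)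
        also have "\<dots> \<le> u * u * w"
          using bounds(2) id(1) \<open>0 \<le> w\<close> by (intro mult_right_mono) auto
        finally show ?thesis .
      qed
      moreover have "D $$ (i', j') - q * (row_sum D i' + col_sum D j') \<ge> - w"
      proof (cases "1 < m")
        case True
        \<comment> \<open>Since q lies between 0 and 1/4, both weights are nonnegative, and the two
          lower bounds add up to (1 - 4q)(-w) + q(-4w) = -w.\<close>
        have "D $$ (i', j') - q * (row_sum D i' + col_sum D j') =
            (1 - 4 * q) * D $$ (i', j') + q * (4 * D $$ (i', j') - row_sum D i' - col_sum D j')"
          by (simp add: algebra_simps)
        moreover have "(1 - 4 * q) * D $$ (i', j') \<ge> (1 - 4 * q) * (- w)"
          using entries(1)[OF i' j'] bounds(3)[OF True] by (intro mult_left_mono) auto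
        moreover have "q * (4 * D $$ (i', j') - row_sum D i' - col_sum D j') \<ge> q * (- (4 * w))"
          using entries(4)[OF i' j'] bounds(1) by (intro mult_left_mono) auto
        ultimately show ?thesis by (simp add: algebra_simps)
      next
        \<comment> \<open>For m = 1 the shift is 1/(2 + sqrt 2), which exceeds 1/4. But
          \<open>D\<close> is then a single entry equal to its row and column sum, and q <= 1/2 puts
          the factor 1 - 2q between 0 and 1.\<close>
        case False
        then have m: "m = 1" "i' = 0" "j' = 0" using i' j' by auto
        then have "row_sum D i' = D $$ (0, 0)" "col_sum D j' = D $$ (0, 0)"
          by (simp_all add: row_sum_def col_sum_def dim)
        then have "D $$ (i', j') - q * (row_sum D i' + col_sum D j') = (1 - 2 * q) * D $$ (0, 0)"
          using m by (simp add: algebra_simps)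
        moreover have "\<bar>(1 - 2 * q) * D $$ (0, 0)\<bar> \<le> 1 * w"
          unfolding abs_mult using bounds m entries(1)[OF i' j'] by (intro mult_mono) auto
        ultimately show ?thesis by simp
      qed
      moreover have "0 \<le> u * u * w" using \<open>0 \<le> w\<close> by simp
      ultimately show ?thesis unfolding N by (simp add: algebra_simps)
    qed
  qed
  then show ?thesis
    unfolding conjugated_index[OF D ij] u2 by simp
qed


section \<open>Matrices with constant row and column sums\<close>

text \<open>The first column of Q is constant, hence an eigenvector of A and of its transpose for r.
  So QAQ has first column and first row (r, 0, ..., 0), and its remaining block serves as
  \<open>D\<close>.\<close>

lemma row_col_sum_decomposition:
  assumes A: "A \<in> carrier_mat (Suc m) (Suc m)"
    and row: "\<And>i. i \<le> m \<Longrightarrow> row_sum A i = r" and col: "\<And>j. j \<le> m \<Longrightarrow> col_sum A j = r"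
  shows "\<exists>D \<in> carrier_mat m m. A = conjugated r D"
proof -
  define u where "u = - (1 / sqrt (real (Suc m)))"
  define Q where "Q = reflector m"
  define E where "E = Q * A * Q"
  define D where "D = mat m m (\<lambda>(i, j). E $$ (Suc i, Suc j))"
  have Q: "Q \<in> carrier_mat (Suc m) (Suc m)" by (simp add: Q_def)
  have E: "E \<in> carrier_mat (Suc m) (Suc m)" using Q A by (simp add: E_def)
  have D: "D \<in> carrier_mat m m" by (simp add: D_def)
  have QQ: "Q * Q = 1\<^sub>m (Suc m)" unfolding Q_def by (rule reflector_involution)
  have QQ_index: "(\<Sum>k<Suc m. Q $$ (i, k) * Q $$ (k, j)) = (if i = j then 1 else 0)"
    if "i \<le> m" "j \<le> m" for i j
  proof -
    have "(\<Sum>k<Suc m. Q $$ (i, k) * Q $$ (k, j)) = (Q * Q) $$ (i, j)"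
      using that Q by (simp add: scalar_prod_def lessThan_atLeast0 del: sum.lessThan_Suc sum.op_ivl_Suc)
    then show ?thesis using that by (simp add: QQ)
  qed
  have first: "Q $$ (i, 0) = u" "Q $$ (0, i) = u" if "i \<le> m" for i
    using that by (simp_all add: Q_def u_def reflector_index)
  have E_col: "E $$ (i, 0) = (if i = 0 then r else 0)" if "i \<le> m" for i
  proof -
    have "E $$ (i, 0) = (\<Sum>k<Suc m. \<Sum>l<Suc m. Q $$ (i, k) * A $$ (k, l) * Q $$ (l, 0))"
      unfolding E_def using Q A that by (intro index_triple_mult) auto
    also have "\<dots> = (\<Sum>k<Suc m. \<Sum>l<Suc m. Q $$ (i, k) * A $$ (k, l) * u)"
      using first by (intro sum.cong refl) (simp add: less_Suc_eq_le)
    also have "\<dots> = (\<Sum>k<Suc m. Q $$ (i, k) * row_sum A k * u)"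
      using A by (simp only: row_sum_def carrier_matD sum_distrib_left sum_distrib_right)
    also have "\<dots> = (\<Sum>k<Suc m. r * (Q $$ (i, k) * Q $$ (k, 0)))"
      using first by (intro sum.cong refl) (simp add: less_Suc_eq_le row)
    also have "\<dots> = r * (if i = 0 then 1 else 0)"
      unfolding sum_distrib_left[symmetric] using QQ_index[OF that, of 0] by simp
    finally show ?thesis by simp
  qed
  have E_row: "E $$ (0, j) = (if j = 0 then r else 0)" if "j \<le> m" for j
  proof -
    have "E $$ (0, j) = (\<Sum>k<Suc m. \<Sum>l<Suc m. Q $$ (0, k) * A $$ (k, l) * Q $$ (l, j))"
      unfolding E_def using Q A that by (intro index_triple_mult) auto
    also have "\<dots> = (\<Sum>l<Suc m. \<Sum>k<Suc m. u * A $$ (k, l) * Q $$ (l, j))"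
      using first by (subst sum.swap) (intro sum.cong refl, simp add: less_Suc_eq_le)
    also have "\<dots> = (\<Sum>l<Suc m. u * col_sum A l * Q $$ (l, j))"
      using A by (simp only: col_sum_def carrier_matD sum_distrib_left sum_distrib_right)
    also have "\<dots> = (\<Sum>l<Suc m. r * (Q $$ (0, l) * Q $$ (l, j)))"
      using first by (intro sum.cong refl) (simp add: less_Suc_eq_le col)
    also have "\<dots> = r * (if j = 0 then 1 else 0)"
      unfolding sum_distrib_left[symmetric] using QQ_index[OF _ that, of 0] by simp
    finally show ?thesis by simp
  qed
  have "E = block_diag (mat 1 1 (\<lambda>_. r)) D"
  proof (rule eq_matI)
    fix i j assume "i < dim_row (block_diag (mat 1 1 (\<lambda>_. r)) D)"
      "j < dim_col (block_diag (mat 1 1 (\<lambda>_. r)) D)"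
    then have "i < Suc m" "j < Suc m" using D by auto
    then show "E $$ (i, j) = block_diag (mat 1 1 (\<lambda>_. r)) D $$ (i, j)"
      using D E_col[of i] E_row[of j] by (cases i; cases j) (auto simp: D_def)
  qed (use D E in auto)
  moreover have "Q * E * Q = A"
  proof -
    have "Q * E * Q = (Q * Q) * A * (Q * Q)"
      using Q A by (simp add: E_def assoc_mult_mat[of _ "Suc m" "Suc m" _ "Suc m" _ "Suc m"])
    then show ?thesis using A by (simp add: QQ)
  qed
  ultimately show ?thesis using D by (intro bexI[of _ D]) (auto simp: conjugated_eq Q_def)
qed

text \<open>From Q^2 = 1 follow BQ = QE and QB = EQ. Comparing the first columns, respectively the
  first rows, gives the sums of B times -u on one side and -ux on the other.\<close>

lemma conjugated_row_col_sum:
  assumes D: "D \<in> carrier_mat m m" and "i \<le> m"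
  shows "row_sum (conjugated x D) i = x" "col_sum (conjugated x D) i = x"
proof -
  define u where "u = 1 / sqrt (real (Suc m))"
  have u: "u \<noteq> 0" by (simp add: u_def)
  define Q where "Q = reflector m"
  define E where "E = block_diag (mat 1 1 (\<lambda>_. x)) D"
  have Q: "Q \<in> carrier_mat (Suc m) (Suc m)" by (simp add: Q_def)
  have E: "E \<in> carrier_mat (Suc m) (Suc m)" using D by (auto simp: E_def)
  have QQ: "Q * Q = 1\<^sub>m (Suc m)" unfolding Q_def by (rule reflector_involution)
  have first: "Q $$ (k, 0) = - u" "Q $$ (0, k) = - u" if "k < Suc m" for k
    using that by (simp_all add: Q_def u_def reflector_index)
  define B where "B = conjugated x D"
  have BE: "B = Q * E * Q" unfolding B_def Q_def E_def by (rule conjugated_eq[OF D])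
  have B: "B \<in> carrier_mat (Suc m) (Suc m)" using D by (simp add: B_def)
  have BQ: "B * Q = Q * E"
    unfolding BE using Q E by (simp add: assoc_mult_mat[of _ "Suc m" "Suc m" _ "Suc m" _ "Suc m"] QQ right_mult_one_mat[OF E])
  have QB: "Q * B = E * Q"
  proof -
    have "Q * B = (Q * Q) * (E * Q)"
      unfolding BE using Q E by (simp add: assoc_mult_mat[of _ "Suc m" "Suc m" _ "Suc m" _ "Suc m"])
    then show ?thesis using Q E by (simp add: QQ)
  qed
  have E0: "E $$ (0, k) = (if k = 0 then x else 0)" "E $$ (k, 0) = (if k = 0 then x else 0)"
    if "k < Suc m" for k
    using that D by (auto simp: E_def)
  have "(B * Q) $$ (i, 0) = (\<Sum>k<Suc m. B $$ (i, k) * Q $$ (k, 0))"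
    using Q B \<open>i \<le> m\<close> by (simp add: scalar_prod_def lessThan_atLeast0 del: sum.lessThan_Suc sum.op_ivl_Suc)
  also have "\<dots> = (\<Sum>k<Suc m. B $$ (i, k) * - u)"
    by (intro sum.cong refl) (simp add: first)
  also have "\<dots> = row_sum B i * - u"
    using B by (simp only: sum_distrib_right row_sum_def carrier_matD)
  finally have "row_sum B i * - u = (Q * E) $$ (i, 0)" unfolding BQ by simp
  also have "\<dots> = (\<Sum>k<Suc m. Q $$ (i, k) * E $$ (k, 0))"
    using Q E \<open>i \<le> m\<close>
    by (simp add: scalar_prod_def lessThan_atLeast0 del: sum.lessThan_Suc sum.op_ivl_Suc)
  also have "\<dots> = (\<Sum>k<Suc m. if k = 0 then Q $$ (i, 0) * x else 0)"
    using E0 by (intro sum.cong refl) auto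
  also have "\<dots> = - u * x" using first(1)[of i] \<open>i \<le> m\<close> by simp
  finally show "row_sum (conjugated x D) i = x" using u by (simp add: B_def)
  have "(Q * B) $$ (0, i) = (\<Sum>k<Suc m. Q $$ (0, k) * B $$ (k, i))"
    using Q B \<open>i \<le> m\<close> by (simp add: scalar_prod_def lessThan_atLeast0 del: sum.lessThan_Suc sum.op_ivl_Suc)
  also have "\<dots> = (\<Sum>k<Suc m. - u * B $$ (k, i))"
    by (intro sum.cong refl) (simp add: first)
  also have "\<dots> = - u * col_sum B i"
    using B by (simp only: sum_distrib_left col_sum_def carrier_matD)
  finally have "- u * col_sum B i = (E * Q) $$ (0, i)" unfolding QB by simp
  also have "\<dots> = (\<Sum>k<Suc m. E $$ (0, k) * Q $$ (k, i))"
    using Q E \<open>i \<le> m\<close>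
    by (simp add: scalar_prod_def lessThan_atLeast0 del: sum.lessThan_Suc sum.op_ivl_Suc)
  also have "\<dots> = (\<Sum>k<Suc m. if k = 0 then x * Q $$ (0, i) else 0)"
    using E0 by (intro sum.cong refl) auto
  also have "\<dots> = - u * x" using first(2)[of i] \<open>i \<le> m\<close> by simp
  finally show "col_sum (conjugated x D) i = x" using u by (simp add: B_def)
qed

text \<open>Evaluate the eigenvector equation at a coordinate of maximal modulus \<open>N\<close>
  and apply the triangle inequality.\<close>

lemma eigenvalue_norm_le_row_sum:
  fixes A :: "real mat"
  assumes A: "A \<in> carrier_mat n n" and nonneg: "nonneg_matrix A"
    and row: "\<And>i. i < n \<Longrightarrow> row_sum A i = r"
    and eigen: "eigenvalue (map_mat complex_of_real A) z"
  shows "cmod z \<le> r"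
proof -
  obtain v where v: "v \<in> carrier_vec n" "v \<noteq> 0\<^sub>v n"
    and Av: "map_mat complex_of_real A *\<^sub>v v = z \<cdot>\<^sub>v v"
    using eigen A by (auto simp: eigenvalue_def eigenvector_def)
  obtain k where k: "k < n" "v $ k \<noteq> 0"
    using v by (metis carrier_vecD eq_vecI index_zero_vec)
  define N where "N = Max ((\<lambda>i. cmod (v $ i)) ` {..<n})"
  have le: "cmod (v $ i) \<le> N" if "i < n" for i
    unfolding N_def using that by (intro Max_ge) auto
  have "N \<in> (\<lambda>i. cmod (v $ i)) ` {..<n}"
    unfolding N_def using k(1) by (intro Max_in) auto
  then obtain i where i: "i < n" "cmod (v $ i) = N" by auto
  have "0 < N" using le[OF k(1)] k(2) by (smt (verit) zero_less_norm_iff)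
  have "z * v $ i = (\<Sum>j<n. complex_of_real (A $$ (i, j)) * v $ j)"
    using arg_cong[OF Av, of "\<lambda>x. x $ i"] A v(1) i(1)
    by (simp add: scalar_prod_def lessThan_atLeast0)
  then have "cmod z * N = cmod (\<Sum>j<n. complex_of_real (A $$ (i, j)) * v $ j)"
    using i(2) by (metis norm_mult)
  also have "\<dots> \<le> (\<Sum>j<n. A $$ (i, j) * N)"
  proof (rule sum_norm_le)
    fix j assume "j \<in> {..<n}"
    then have "0 \<le> A $$ (i, j)" "cmod (v $ j) \<le> N"
      using nonneg A i(1) le by (auto simp: nonneg_matrix_def)
    then show "cmod (complex_of_real (A $$ (i, j)) * v $ j) \<le> A $$ (i, j) * N"
      by (simp add: norm_mult mult_left_mono)
  qed
  also have "\<dots> = row_sum A i * N"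
    using A by (simp add: row_sum_def sum_distrib_right)
  finally show ?thesis using \<open>0 < N\<close> row[OF i(1)] by simp
qed

section \<open>The set of admissible Perron eigenvalues\<close>

text \<open>The common row and column sum is fixed to be \<open>x\<close> itself and the spectrum is
  a polynomial identity, so that every condition survives an entrywise limit.\<close>

definition realizes :: "nat \<Rightarrow> complex list \<Rightarrow> real \<Rightarrow> real mat \<Rightarrow> bool" where
  "realizes n ls x A \<longleftrightarrow> A \<in> carrier_mat n n \<and> nonneg_matrix A \<and>
     (\<forall>i<n. row_sum A i = x \<and> col_sum A i = x) \<and>
     map_poly complex_of_real (char_poly A) = [:- complex_of_real x, 1:] * linear_factors (mset ls) \<and>
     0 \<le> x \<and> (\<forall>z \<in> set ls. cmod z \<le> x)"

text \<open>The common row sum \<open>r\<close> is an eigenvalue, so \<open>r \<le> x\<close>; and no eigenvalue exceeds \<open>r\<close> in modulus,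
  so \<open>x \<le> r\<close>.\<close>

lemma realizes_iff:
  "realizes (Suc m) ls x A \<longleftrightarrow>
     A \<in> carrier_mat (Suc m) (Suc m) \<and> gen_doubly_stochastic A \<and> realizable_by x ls A"
proof
  assume R: "realizes (Suc m) ls x A"
  then have "A \<in> carrier_mat (Suc m) (Suc m)" by (simp add: realizes_def)
  with R show "A \<in> carrier_mat (Suc m) (Suc m) \<and> gen_doubly_stochastic A \<and> realizable_by x ls A"
    by (auto simp: realizes_def gen_doubly_stochastic_def realizable_by_def row_sum_def col_sum_def
        eigenvalues_mset_eq_iff simp del: sum.lessThan_Suc intro!: exI[of _ x])
next
  assume R: "A \<in> carrier_mat (Suc m) (Suc m) \<and> gen_doubly_stochastic A \<and> realizable_by x ls A"
  then have A: "A \<in> carrier_mat (Suc m) (Suc m)" and nonneg: "nonneg_matrix A"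
    and bound: "0 \<le> x" "\<And>z. z \<in> set ls \<Longrightarrow> cmod z \<le> x"
    and eigen: "eigenvalues_mset A = mset (complex_of_real x # ls)"
    by (auto simp: realizable_by_def)
  from R obtain r where r: "r \<ge> 0" "\<And>i. i < Suc m \<Longrightarrow> row_sum A i = r"
    "\<And>i. i < Suc m \<Longrightarrow> col_sum A i = r"
    by (auto simp: gen_doubly_stochastic_def row_sum_def col_sum_def simp del: sum.lessThan_Suc)
  have cp: "map_poly complex_of_real (char_poly A) = [:- complex_of_real x, 1:] * linear_factors (mset ls)"
    using eigen unfolding eigenvalues_mset_eq_iff[OF A] by simp
  have roots: "eigenvalue (map_mat complex_of_real A) z \<longleftrightarrow> z = complex_of_real x \<or> z \<in> set ls" for z
  proof -
    have "eigenvalue (map_mat complex_of_real A) z \<longleftrightarrow> poly (map_poly complex_of_real (char_poly A)) z = 0"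
      using eigenvalue_root_char_poly[of "map_mat complex_of_real A" "Suc m" z] A
      by (simp add: complex_char_poly[OF A])
    also have "\<dots> \<longleftrightarrow> z = complex_of_real x \<or> z \<in> set ls"
      unfolding cp by (auto simp: poly_prod_mset prod_mset_zero_iff simp del: mult_pCons_left)
    finally show ?thesis .
  qed
  obtain D where D: "D \<in> carrier_mat m m" "A = conjugated r D"
    using row_col_sum_decomposition[OF A, of r] r by auto
  \<comment> \<open>The decomposition exhibits X - r as a factor of the characteristic polynomial of
    \<open>A\<close>.\<close>
  have "poly (map_poly complex_of_real (char_poly A)) (complex_of_real r) = 0"
    unfolding D(2) conjugated_char_poly[OF D(1)] map_poly_complex_of_real_mult
    by (simp add: map_poly_pCons)
  then have "eigenvalue (map_mat complex_of_real A) (complex_of_real r)"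
    using eigenvalue_root_char_poly[of "map_mat complex_of_real A" "Suc m" "complex_of_real r"] A
    by (simp add: complex_char_poly[OF A])
  then have "r \<le> x" using roots[of "complex_of_real r"] bound r(1) by force
  moreover have "x \<le> r"
    using eigenvalue_norm_le_row_sum[OF A nonneg r(2), of "complex_of_real x"] roots bound(1) by auto
  ultimately have "r = x" by simp
  then show "realizes (Suc m) ls x A"
    using A nonneg r bound cp by (simp add: realizes_def)
qed

text \<open>Keep \<open>D\<close> and replace \<open>x\<close> by \<open>y\<close>: cancelling X - x
  shows that \<open>D\<close> carries exactly the spectrum \<open>ls\<close>, and no entry
  decreases.\<close>

lemma realizes_mono:
  assumes R: "realizes (Suc m) ls x A" and "x \<le> y"
  shows "\<exists>B. realizes (Suc m) ls y B"
proof -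
  have A: "A \<in> carrier_mat (Suc m) (Suc m)" using R by (simp add: realizes_def)
  obtain D where D: "D \<in> carrier_mat m m" "A = conjugated x D"
    using row_col_sum_decomposition[OF A, of x] R by (auto simp: realizes_def)
  have "[:- complex_of_real x, 1:] * map_poly complex_of_real (char_poly D)
      = [:- complex_of_real x, 1:] * linear_factors (mset ls)"
    using R unfolding realizes_def D(2) conjugated_char_poly[OF D(1)] map_poly_complex_of_real_mult
    by (simp add: map_poly_pCons del: mult_pCons_left)
  then have cp: "map_poly complex_of_real (char_poly D) = linear_factors (mset ls)"
    by (metis mult_cancel_left pCons_eq_0_iff one_neq_zero)
  have "0 \<le> conjugated y D $$ (i, j)" if "i \<le> m" "j \<le> m" for i j
  proof -
    have "0 \<le> A $$ (i, j)" using R A that by (auto simp: realizes_def nonneg_matrix_def)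
    also have "\<dots> \<le> conjugated y D $$ (i, j)"
      unfolding D(2) conjugated_index[OF D(1) that] using \<open>x \<le> y\<close>
      by (simp add: divide_right_mono)
    finally show ?thesis .
  qed
  then have "nonneg_matrix (conjugated y D)"
    using conjugated_carrier[OF D(1), of y] by (auto simp: nonneg_matrix_def)
  moreover have "0 \<le> y" "\<And>z. z \<in> set ls \<Longrightarrow> cmod z \<le> y"
    using R \<open>x \<le> y\<close> by (auto simp: realizes_def intro: order_trans)
  ultimately have "realizes (Suc m) ls y (conjugated y D)"
    using conjugated_carrier[OF D(1), of y] conjugated_row_col_sum[OF D(1)]
      conjugated_char_poly[OF D(1)] cp
    by (simp add: realizes_def map_poly_complex_of_real_mult map_poly_pCons del: mult_pCons_left)
  then show ?thesis by blast
qed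

section \<open>Compactness and limits of realizing matrices\<close>

text \<open>Bolzano-Weierstrass one coordinate at a time: each new index refines the subsequence to
  one that is monotone there. It is applied to the positions of a matrix.\<close>

lemma convergent_subsequence_finite_family:
  fixes f :: "nat \<Rightarrow> 'i \<Rightarrow> real"
  assumes "finite I" and "\<And>k i. i \<in> I \<Longrightarrow> \<bar>f k i\<bar> \<le> b"
  shows "\<exists>r g. strict_mono (r :: nat \<Rightarrow> nat) \<and> (\<forall>i\<in>I. (\<lambda>k. f (r k) i) \<longlonglongrightarrow> g i)"
  using assms
proof (induction I rule: finite_induct)
  case empty
  then show ?case by (auto intro: exI[of _ id] strict_mono_id)
next
  case (insert a I)
  have "\<exists>r g. strict_mono (r :: nat \<Rightarrow> nat) \<and> (\<forall>i\<in>I. (\<lambda>k. f (r k) i) \<longlonglongrightarrow> g i)"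
    by (rule insert.IH) (use insert.prems in auto)
  then obtain r g where r: "strict_mono (r :: nat \<Rightarrow> nat)"
    "\<And>i. i \<in> I \<Longrightarrow> (\<lambda>k. f (r k) i) \<longlonglongrightarrow> g i"
    by blast
  obtain s where s: "strict_mono s" "monoseq (\<lambda>k. f (r (s k)) a)"
    using seq_monosub[of "\<lambda>k. f (r k) a"] by (auto simp: o_def)
  have "Bseq (\<lambda>k. f (r (s k)) a)" using insert.prems by (intro BseqI'[of _ b]) auto
  then obtain c where "(\<lambda>k. f (r (s k)) a) \<longlonglongrightarrow> c"
    using Bseq_monoseq_convergent s(2) by (auto simp: convergent_def)
  moreover have "(\<lambda>k. f (r (s k)) i) \<longlonglongrightarrow> g i" if "i \<in> I" for i
    using LIMSEQ_subseq_LIMSEQ[OF r(2)[OF that] s(1)] by (simp add: o_def)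
  moreover have "strict_mono (\<lambda>k. r (s k))"
    using strict_mono_o[OF r(1) s(1)] by (simp add: o_def)
  ultimately show ?case
    using insert.hyps(2) by (intro exI[of _ "\<lambda>k. r (s k)"] exI[of _ "g(a := c)"]) auto
qed

text \<open>By the Leibniz formula the determinant is a polynomial in the entries.\<close>

lemma tendsto_det:
  fixes M :: "nat \<Rightarrow> 'a :: {real_normed_field} mat"
  assumes "\<And>k. M k \<in> carrier_mat n n" and "L \<in> carrier_mat n n"
    and "\<And>i j. i < n \<Longrightarrow> j < n \<Longrightarrow> (\<lambda>k. M k $$ (i, j)) \<longlonglongrightarrow> L $$ (i, j)"
  shows "(\<lambda>k. det (M k)) \<longlonglongrightarrow> det L"
  unfolding det_def'[OF assms(1)] det_def'[OF assms(2)]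
  by (intro tendsto_sum tendsto_mult tendsto_const tendsto_prod assms(3))
    (auto simp: permutes_in_image)

lemma realizes_limit:
  assumes R: "\<And>k. realizes n ls (x k) (A k)" and x: "x \<longlonglongrightarrow> y"
    and L: "L \<in> carrier_mat n n"
    and lim: "\<And>i j. i < n \<Longrightarrow> j < n \<Longrightarrow> (\<lambda>k. A k $$ (i, j)) \<longlonglongrightarrow> L $$ (i, j)"
  shows "realizes n ls y L"
proof -
  have A: "A k \<in> carrier_mat n n" for k using R[of k] by (simp add: realizes_def)
  have "0 \<le> L $$ (i, j)" if "i < n" "j < n" for i j
  proof -
    have "0 \<le> A k $$ (i, j)" for k
      using R[of k] A[of k] that by (simp add: realizes_def nonneg_matrix_def)
    then show ?thesis using LIMSEQ_le_const[OF lim[OF that]] by blast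
  qed
  then have nonneg: "nonneg_matrix L" using L by (auto simp: nonneg_matrix_def)
  have sums: "row_sum L i = y" "col_sum L i = y" if "i < n" for i
  proof -
    have "(\<lambda>k. row_sum (A k) i) \<longlonglongrightarrow> row_sum L i" "(\<lambda>k. col_sum (A k) i) \<longlonglongrightarrow> col_sum L i"
      unfolding row_sum_def col_sum_def carrier_matD[OF A] carrier_matD[OF L]
      using that by (auto intro!: tendsto_sum lim)
    moreover have "row_sum (A k) i = x k" "col_sum (A k) i = x k" for k
      using R[of k] that by (auto simp: realizes_def)
    ultimately show "row_sum L i = y" "col_sum L i = y"
      using x by (auto intro: LIMSEQ_unique)
  qed
  have "map_poly complex_of_real (char_poly L) = [:- complex_of_real y, 1:] * linear_factors (mset ls)"
  \<comment> \<open>The identity is checked pointwise: at a fixed \<open>z\<close> the value is the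
    determinant of zI - L, the limit of the determinants of zI - A_k.\<close>
  proof (intro poly_eq_poly_eq_iff[THEN iffD1] ext)
    fix z :: complex
    let ?C = "\<lambda>B. - char_matrix (map_mat complex_of_real B) z"
    have poly: "poly (map_poly complex_of_real (char_poly B)) z = det (?C B)"
      if "B \<in> carrier_mat n n" for B
      using char_poly_matrix[of "map_mat complex_of_real B" n z] that
      by (simp add: complex_char_poly)
    have "(\<lambda>k. det (?C (A k))) \<longlonglongrightarrow> det (?C L)"
    proof (rule tendsto_det)
      fix i j assume ij: "i < n" "j < n"
      show "(\<lambda>k. ?C (A k) $$ (i, j)) \<longlonglongrightarrow> ?C L $$ (i, j)"
        using ij carrier_matD[OF A] carrier_matD[OF L]
        by (auto simp: char_matrix_def intro!: tendsto_intros lim)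
    qed (use A L in auto)
    moreover have "det (?C (A k)) = (z - complex_of_real (x k)) * poly (linear_factors (mset ls)) z" for k
      using R[of k] unfolding poly[OF A, symmetric] realizes_def
      by (simp del: mult_pCons_left)
    moreover have "(\<lambda>k. (z - complex_of_real (x k)) * poly (linear_factors (mset ls)) z)
        \<longlonglongrightarrow> (z - complex_of_real y) * poly (linear_factors (mset ls)) z"
      by (intro tendsto_intros x)
    ultimately show "poly (map_poly complex_of_real (char_poly L)) z
        = poly ([:- complex_of_real y, 1:] * linear_factors (mset ls)) z"
      unfolding poly[OF L] by (auto intro: LIMSEQ_unique simp del: mult_pCons_left)
  qed
  moreover have "c \<le> y" if "\<And>k. c \<le> x k" for c
    using LIMSEQ_le_const[OF x] that by blast
  then have "0 \<le> y" "\<And>z. z \<in> set ls \<Longrightarrow> cmod z \<le> y"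
    using R by (simp_all add: realizes_def)
  ultimately show ?thesis using L nonneg sums by (simp add: realizes_def)
qed

text \<open>The entries lie between 0 and the row sum \<open>x k\<close>, which is bounded because
  \<open>x\<close> converges; so some subsequence of the matrices converges entrywise.\<close>

lemma realizes_closed:
  assumes R: "\<And>k. realizes n ls (x k) (A k)" and x: "x \<longlonglongrightarrow> y"
  shows "\<exists>L. realizes n ls y L"
proof -
  have A: "A k \<in> carrier_mat n n" for k using R[of k] by (simp add: realizes_def)
  obtain b where b: "\<And>k. \<bar>x k\<bar> \<le> b"
    using convergent_imp_Bseq[OF convergentI[OF x]] by (auto simp: Bseq_def)
  have bound: "\<bar>A k $$ p\<bar> \<le> b" if p: "p \<in> {..<n} \<times> {..<n}" for k p
  proof -
    obtain i j where ij: "p = (i, j)" "i < n" "j < n" using p by auto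
    have nonneg: "0 \<le> A k $$ (i, j')" if "j' < n" for j'
      using R[of k] A[of k] ij that by (auto simp: realizes_def nonneg_matrix_def)
    have "A k $$ (i, j) \<le> row_sum (A k) i"
      unfolding row_sum_def carrier_matD[OF A]
      using ij nonneg by (intro member_le_sum) auto
    also have "\<dots> = x k" using R[of k] ij by (simp add: realizes_def)
    finally show ?thesis using nonneg[OF ij(3)] b[of k] ij(1) by simp
  qed
  obtain r g where r: "strict_mono (r :: nat \<Rightarrow> nat)"
    "\<And>p. p \<in> {..<n} \<times> {..<n} \<Longrightarrow> (\<lambda>k. A (r k) $$ p) \<longlonglongrightarrow> g p"
    using convergent_subsequence_finite_family[of "{..<n} \<times> {..<n}" "\<lambda>k p. A k $$ p" b] bound
    by blast
  have "realizes n ls y (mat n n g)"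
  proof (rule realizes_limit[of n ls "\<lambda>k. x (r k)" "\<lambda>k. A (r k)"])
    show "(\<lambda>k. x (r k)) \<longlonglongrightarrow> y"
      using LIMSEQ_subseq_LIMSEQ[OF x r(1)] by (simp add: o_def)
  qed (use R r(2) in auto)
  then show ?thesis by blast
qed

section \<open>The upper bound and the least admissible value\<close>

lemma realizes_upper_bound:
  assumes len: "length ls = m" and "0 < m" and conj: "mset (map cnj ls) = mset ls"
    and w: "\<And>z. z \<in> set ls \<Longrightarrow> \<bar>Re z\<bar> \<le> w \<and> \<bar>Im z\<bar> \<le> w" and "0 \<le> w"
  shows "\<exists>A. realizes (Suc m) ls ((real (Suc m) + 2) * w) A"
proof -
  let ?x = "(real (Suc m) + 2) * w"
  obtain D where D: "D \<in> carrier_mat m m" "balanced w D"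
    and cp: "map_poly complex_of_real (char_poly D) = linear_factors (mset ls)"
    using balanced_realization[of "mset ls" w] conj w \<open>0 \<le> w\<close> len by auto
  \<comment> \<open>The choice of \<open>?x\<close> makes its contribution to each entry cancel
    exactly the worst deficit in \<open>conjugated_lower_bound\<close>.\<close>
  have "?x / real (Suc m) = (1 + 2 / real (Suc m)) * w" by (simp add: field_simps)
  then have "0 \<le> conjugated ?x D $$ (i, j)" if "i \<le> m" "j \<le> m" for i j
    using conjugated_lower_bound[OF D \<open>0 < m\<close> \<open>0 \<le> w\<close> that, of ?x] by simp
  then have "nonneg_matrix (conjugated ?x D)"
    using conjugated_carrier[OF D(1), of ?x] by (auto simp: nonneg_matrix_def)
  moreover have "cmod z \<le> ?x" if "z \<in> set ls" for z
  proof -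
    have "cmod z \<le> 2 * w" using cmod_le[of z] w[OF that] by linarith
    also have "\<dots> \<le> ?x" using \<open>0 \<le> w\<close> by (intro mult_right_mono) auto
    finally show ?thesis .
  qed
  ultimately have "realizes (Suc m) ls ?x (conjugated ?x D)"
    using conjugated_carrier[OF D(1), of ?x] conjugated_row_col_sum[OF D(1)]
      conjugated_char_poly[OF D(1)] cp \<open>0 \<le> w\<close>
    by (simp add: realizes_def map_poly_complex_of_real_mult map_poly_pCons del: mult_pCons_left)
  then show ?thesis by blast
qed

theorem theorem4p1:
  fixes n :: nat and ls :: "complex list" and w :: real
  assumes "n \<ge> 2" and "length ls = n - 1"
    and "mset (map cnj ls) = mset ls"
    and "w = Min (\<Union>z \<in> set ls. {Re z, - Re z, Im z, - Im z})"
  shows "let S = {x0 :: real.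
             Max (cmod ` set ls) \<le> x0 \<and> x0 \<le> (real n + 2) * \<bar>w\<bar> \<and>
             (\<forall>x :: real.
                (\<exists>A \<in> carrier_mat n n. gen_doubly_stochastic A \<and> realizable_by x ls A)
                \<longleftrightarrow> x0 \<le> x)}
         in \<exists>x0 \<in> S. \<forall>y \<in> S. x0 \<le> y"
proof -
  obtain m where m: "n = Suc m" "0 < m" using assms(1) by (cases n) auto
  define T where "T = {x. \<exists>A. realizes n ls x A}"
  have T_iff: "(\<exists>A \<in> carrier_mat n n. gen_doubly_stochastic A \<and> realizable_by x ls A) \<longleftrightarrow> x \<in> T" for x
    unfolding T_def m(1) realizes_iff by blast
  have ls: "set ls \<noteq> {}" using assms(2) m by auto
  \<comment> \<open>The set is closed under negation, so its minimum is minus the largest modulus of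
    a real or imaginary part.\<close>
  have w: "\<bar>Re z\<bar> \<le> \<bar>w\<bar> \<and> \<bar>Im z\<bar> \<le> \<bar>w\<bar>" if "z \<in> set ls" for z
  proof -
    have "w \<le> Re z" "w \<le> - Re z" "w \<le> Im z" "w \<le> - Im z"
      unfolding assms(4) using that by (auto intro!: Min_le)
    then show ?thesis by linarith
  qed
  have top: "(real n + 2) * \<bar>w\<bar> \<in> T"
    using realizes_upper_bound[of ls m "\<bar>w\<bar>"] assms(2,3) m w unfolding T_def m(1) by simp
  have T_ge: "Max (cmod ` set ls) \<le> x" if "x \<in> T" for x
    using that ls by (auto simp: T_def realizes_def)
  then have bdd: "bdd_below T" by (rule bdd_belowI)
  define x0 where "x0 = Inf T"
  have le: "x0 \<le> x" if "x \<in> T" for x unfolding x0_def using that bdd by (rule cInf_lower)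
  have up: "y \<in> T" if "x \<in> T" "x \<le> y" for x y
    using that realizes_mono[of m ls x _ y] unfolding T_def m(1) by blast
  \<comment> \<open>Some element of \<open>T\<close> lies below \<open>x\<close>, and
    \<open>T\<close> is upward closed.\<close>
  have above: "x \<in> T" if "x0 < x" for x
    using cInf_lessD[of T x] that top up unfolding x0_def by (metis empty_iff less_imp_le)
  have "x0 \<in> T"
  proof -
    \<comment> \<open>These admissible values decrease to the infimum, which is therefore admissible
      by closedness.\<close>
    have "x0 + inverse (real (Suc k)) \<in> T" for k by (rule above) simp
    then obtain A where A: "\<And>k. realizes n ls (x0 + inverse (real (Suc k))) (A k)"
      unfolding T_def mem_Collect_eq by metis
    then show ?thesis
      using realizes_closed[OF A LIMSEQ_inverse_real_of_nat_add] unfolding T_def by blast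
  qed
  have "x \<in> T \<longleftrightarrow> x0 \<le> x" for x using le up[OF \<open>x0 \<in> T\<close>] by blast
  \<comment> \<open>Any member y of the set in the claim satisfies the same equivalence, so y itself
    is in \<open>T\<close> and \<open>x0\<close> is at most y.\<close>
  then show ?thesis
    unfolding Let_def T_iff using T_ge[OF \<open>x0 \<in> T\<close>] le[OF top] by auto
qed

end
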